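(* For $n\ge2$ let $C_n$ be the $n\times n$ matrix whose $(i,j)$ entry is $1$ if $j=1$ or $i\mid j$, and $0$ otherwise. There exist positive integers $n$ for which some small nontrivial eigenvalue $\lambda$ of $C_n$ satisfies both $|\lambda|>1$ and $\operatorname{Re}(\lambda)>1$. Consequently, both parts of the following conjecture of Barrett and Jarvis are false: every small nontrivial eigenvalue $\lambda$ of $C_n$ satisfies (i) $|\lambda|<1$, and (ii) $\operatorname{Re}(\lambda)<1$.
   Context: The eigenvalue $1$ of $C_n$ is called trivial and eigenvalues $\lambda\neq1$ are called nontrivial; counted with algebraic multiplicity there are $\lfloor\log_2 n\rfloor+1$ nontrivial eigenvalues. Barrett and Jarvis showed that $C_n$ has two large real eigenvalues $\lambda_\pm=\pm\sqrt n+\log\sqrt n+\gamma-\tfrac12+O\big(\tfrac{\log^2 n}{\sqrt n}\big)$ (with $\gamma$ Euler's constant), and that, for any small $\epsilon>0$, the remaining nontrivial eigenvalues satisfy $|\lambda|<\log_{2-\epsilon}n$ for all sufficiently large $n$. The small nontrivial eigenvalues of $C_n$ are the remaining $\lfloor\log_2 n\rfloor-1$ nontrivial eigenvalues (counted with multiplicity) other than $\lambda_+$ and $\lambda_-$; for a given $n$, $\lambda_+$ and $\lambda_-$ are the two nontrivial eigenvalues of largest absolute value. *)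

theory Defs
  imports
    Jordan_Normal_Form.Char_Poly
    "HOL-Computational_Algebra.Fundamental_Theorem_Algebra"
begin

text \<open>Matrix indices start at 0 here, so the mathematical entry at position
  \<open>(i + 1, j + 1)\<close> is the one at position \<open>(i, j)\<close>.\<close>

definition redheffer :: "nat \<Rightarrow> complex mat" where
  "redheffer n = mat n n (\<lambda>(i, j). if j = 0 \<or> Suc i dvd Suc j then 1 else 0)"

text \<open>Eigenvalues are counted with algebraic multiplicity, that is, as roots of the
  characteristic polynomial.\<close>

definition nontrivial_eigenvalues :: "nat \<Rightarrow> complex multiset" where
  "nontrivial_eigenvalues n = {#\<mu> \<in># proots (char_poly (redheffer n)). \<mu> \<noteq> 1#}"

text \<open>The two nontrivial eigenvalues of largest absolute value. The inequality is strict, so the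
  pair is unique up to order whenever it exists, and no eigenvalue counts as small merely because
  of how a tie in absolute value is broken.\<close>

definition large_eigenvalue_pair :: "nat \<Rightarrow> complex \<Rightarrow> complex \<Rightarrow> bool" where
  "large_eigenvalue_pair n a b \<longleftrightarrow>
     {#a, b#} \<subseteq># nontrivial_eigenvalues n \<and>
     (\<forall>\<mu> \<in># nontrivial_eigenvalues n - {#a, b#}. cmod \<mu> < cmod a \<and> cmod \<mu> < cmod b)"

definition small_nontrivial_eigenvalue :: "nat \<Rightarrow> complex \<Rightarrow> bool" where
  "small_nontrivial_eigenvalue n \<mu> \<longleftrightarrow>
     (\<exists>a b. large_eigenvalue_pair n a b \<and> \<mu> \<in># nontrivial_eigenvalues n - {#a, b#})"

end

theory Submission
  imports Defs
begin

text \<open>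
  Write \<open>x = \<lambda> - 1\<close> and let \<open>D\<^sub>k(n)\<close> be the number of \<open>k\<close>-tuples of integers \<open>\<ge> 2\<close> with
  product at most \<open>n\<close>. The nontrivial eigenvalues correspond to the roots of
  \<open>x\<^sup>r\<^sup>+\<^sup>1 - (\<Sum>k = 1..r. D\<^sub>k(n) x\<^sup>r\<^sup>-\<^sup>k)\<close> with \<open>r = \<lfloor>log\<^sub>2 n\<rfloor>\<close>. Take \<open>n = 2\<^sup>r\<close>. A tuple counted by
  \<open>D\<^sub>r\<^sub>-\<^sub>j(n)\<close> has at most \<open>\<lfloor>j log 2 / log (3/2)\<rfloor>\<close> entries different from \<open>2\<close>, so for \<open>j = 0, 1, 2, 3\<close>
  these numbers have orders of magnitude \<open>1, r, r\<^sup>3, r\<^sup>5\<close>. If all roots but the large positive one had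
  real part \<open>\<le> 0\<close>, then dividing that root out would leave a stable polynomial, whose four lowest
  coefficients satisfy the Hurwitz inequality \<open>q\<^sub>0 q\<^sub>3 \<le> q\<^sub>1 q\<^sub>2\<close>; but \<open>1 \<cdot> r\<^sup>5\<close> exceeds \<open>r \<cdot> r\<^sup>3\<close> for
  large \<open>r\<close>.

  To identify the two large eigenvalues, put \<open>n = 4 R\<^sup>2\<close>. Outside the disc \<open>\<bar>x\<bar> < R\<close> the equation is a small
  perturbation of \<open>x\<^sup>2 = n - 1\<close>, so two distinct roots there are almost opposite, which leaves room
  for only two.
\<close>

section \<open>Counting ordered factorizations\<close>

text \<open>\<open>tuple_count k n\<close> is \<open>D\<^sub>k(n)\<close>; the recursion fixes the first factor \<open>m\<close>.\<close>

primrec tuple_count :: "nat \<Rightarrow> nat \<Rightarrow> nat" where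
  "tuple_count 0 n = (if 1 \<le> n then 1 else 0)"
| "tuple_count (Suc k) n = (\<Sum>m = 2..n. tuple_count k (n div m))"

lemma tuple_count_eq_0: "n < 2 ^ k \<Longrightarrow> tuple_count k n = 0"
proof (induction k arbitrary: n)
  case (Suc k)
  have "tuple_count k (n div m) = 0" if "m \<in> {2..n}" for m
  proof (rule Suc.IH)
    have "n div m \<le> n div 2" using that by (intro div_le_mono2) auto
    also have "\<dots> < 2 ^ k" using Suc.prems by (simp add: less_mult_imp_div_less mult.commute)
    finally show "n div m < 2 ^ k" .
  qed
  then show ?case by simp
qed simp

lemma tuple_count_1: "tuple_count (Suc 0) n = n - 1"
proof -
  have "n div m \<ge> 1" if "m \<in> {2..n}" for m
    using that by (simp add: Suc_leI div_greater_zero_iff)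
  then show ?thesis by simp
qed

text \<open>The last k factors multiply to at least 2^k, so the first one is at most M. This cuts
  the recursion down to a number of terms independent of n.\<close>

lemma tuple_count_Suc_le:
  assumes "n < 2 ^ k * Suc M"
  shows "tuple_count (Suc k) n \<le> (\<Sum>m = 2..M. tuple_count k (n div m))"
proof -
  have zero: "tuple_count k (n div m) = 0" if "m \<in> {2..n} - {2..M}" for m
  proof (rule tuple_count_eq_0)
    have "Suc M \<le> m" "m > 0" using that by auto
    then have "n < 2 ^ k * m"
      using assms by (meson less_le_trans mult_le_mono2)
    then show "n div m < 2 ^ k" by (simp add: less_mult_imp_div_less)
  qed
  have "tuple_count (Suc k) n = (\<Sum>m \<in> {2..n} \<inter> {2..M}. tuple_count k (n div m))"
    unfolding tuple_count.simps
    by (rule sum.mono_neutral_right) (use zero in auto)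
  also have "\<dots> \<le> (\<Sum>m = 2..M. tuple_count k (n div m))"
    by (rule sum_mono2) auto
  finally show ?thesis .
qed

text \<open>Compared with the all-2 tuple, each entry different from 2 multiplies the product by at
  least 3/2. If n / 2^k is below 3/2, no such entry fits; the bounds 9/4 = (3/2)^2, 27/8 = (3/2)^3
  and 9/2 < (3/2)^4 in the next lemmas allow at most one, two and three. A first factor m turns a
  bound c into 2c/m.\<close>

lemma tuple_count_le_1: "2 * n < 3 * 2 ^ k \<Longrightarrow> tuple_count k n \<le> 1"
proof (induction k arbitrary: n)
  case (Suc k)
  have "tuple_count (Suc k) n \<le> (\<Sum>m = 2..2. tuple_count k (n div m))"
    by (rule tuple_count_Suc_le) (use Suc.prems in auto)
  also have "\<dots> \<le> 1"
    using Suc.IH[of "n div 2"] Suc.prems by simp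
  finally show ?case .
qed simp

lemma atLeastAtMost_2_4: "{2..4} = {2,3,4::nat}"
  by auto

lemma atLeastAtMost_2_6: "{2..6} = {2,3,4,5,6::nat}"
  by auto

lemma atLeastAtMost_2_8: "{2..8} = {2,3,4,5,6,7,8::nat}"
  by auto

lemma tuple_count_le_linear: "4 * n < 9 * 2 ^ k \<Longrightarrow> tuple_count k n \<le> 2 * k + 1"
proof (induction k arbitrary: n)
  case (Suc k)
  have "tuple_count (Suc k) n \<le> (\<Sum>m = 2..4. tuple_count k (n div m))"
    by (rule tuple_count_Suc_le) (use Suc.prems in auto)
  also have "\<dots> = tuple_count k (n div 2) + tuple_count k (n div 3) + tuple_count k (n div 4)"
    by (simp add: atLeastAtMost_2_4)
  also have "\<dots> \<le> (2 * k + 1) + 1 + 1"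
    by (intro add_mono Suc.IH tuple_count_le_1) (use Suc.prems in auto)
  finally show ?case by simp
qed simp

lemma tuple_count_le_quadratic: "8 * n < 27 * 2 ^ k \<Longrightarrow> tuple_count k n \<le> (2 * k + 1) ^ 2"
proof (induction k arbitrary: n)
  case (Suc k)
  have "tuple_count (Suc k) n \<le> (\<Sum>m = 2..6. tuple_count k (n div m))"
    by (rule tuple_count_Suc_le) (use Suc.prems in auto)
  also have "\<dots> = tuple_count k (n div 2) + tuple_count k (n div 3) + tuple_count k (n div 4)
      + tuple_count k (n div 5) + tuple_count k (n div 6)"
    by (simp add: atLeastAtMost_2_6)
  also have "\<dots> \<le> (2 * k + 1) ^ 2 + (2 * k + 1) + (2 * k + 1) + 1 + 1"
    by (intro add_mono Suc.IH tuple_count_le_1 tuple_count_le_linear) (use Suc.prems in auto)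
  also have "\<dots> \<le> (2 * Suc k + 1) ^ 2"
    by (simp add: power2_eq_square algebra_simps)
  finally show ?case .
qed simp

text \<open>The ratio 4 has to be covered; the bound 9/2 does so and keeps the first factor at most
  8.\<close>

lemma tuple_count_le_cubic: "2 * n < 9 * 2 ^ k \<Longrightarrow> tuple_count k n \<le> (2 * k + 1) ^ 3"
proof (induction k arbitrary: n)
  case (Suc k)
  have "tuple_count (Suc k) n \<le> (\<Sum>m = 2..8. tuple_count k (n div m))"
    by (rule tuple_count_Suc_le) (use Suc.prems in auto)
  also have "\<dots> = tuple_count k (n div 2) + tuple_count k (n div 3) + tuple_count k (n div 4)
      + tuple_count k (n div 5) + tuple_count k (n div 6) + tuple_count k (n div 7) + tuple_count k (n div 8)"
    by (simp add: atLeastAtMost_2_8)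
  also have "\<dots> \<le> (2 * k + 1) ^ 3 + (2 * k + 1) ^ 2 + (2 * k + 1) ^ 2 + (2 * k + 1) + (2 * k + 1) + 1 + 1"
    by (intro add_mono Suc.IH tuple_count_le_1 tuple_count_le_linear tuple_count_le_quadratic)
      (use Suc.prems in auto)
  also have "\<dots> \<le> (2 * Suc k + 1) ^ 3"
    by (simp add: power2_eq_square power3_eq_cube algebra_simps)
  finally show ?case .
qed simp

text \<open>Only tuples with t entries 3 and k - t entries 2 are counted; splitting by the first
  entry is Pascal's rule.\<close>

lemma binomial_le_tuple_count:
  "t \<le> k \<Longrightarrow> 2 ^ (k - t) * 3 ^ t \<le> n \<Longrightarrow> k choose t \<le> tuple_count k n"
proof (induction k arbitrary: t n)
  case (Suc k)
  have pos: "(1::nat) \<le> 2 ^ k" "(1::nat) \<le> 2 ^ (k - s) * 3 ^ s" for s by simp_all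
  show ?case
  proof (cases t)
    case 0
    then have n: "2 * 2 ^ k \<le> n" using Suc.prems by simp
    have "1 \<le> tuple_count k (n div 2)" using Suc.IH[of 0 "n div 2"] n by simp
    also have "\<dots> = (\<Sum>m\<in>{2}. tuple_count k (n div m))" by simp
    also have "\<dots> \<le> tuple_count (Suc k) n"
      unfolding tuple_count.simps by (rule sum_mono2) (use order_trans[OF mult_le_mono2[OF pos(1), of 2] n] in simp_all)
    finally show ?thesis using 0 by simp
  next
    case (Suc s)
    then have n: "3 * (2 ^ (k - s) * 3 ^ s) \<le> n" and s: "s \<le> k" using Suc.prems by auto
    have 3: "k choose s \<le> tuple_count k (n div 3)"
      by (rule Suc.IH) (use n s in auto)
    have 2: "k choose t \<le> tuple_count k (n div 2)"
    proof (cases "t \<le> k")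
      case True
      then have "2 ^ (Suc k - t) = 2 * (2::nat) ^ (k - t)" by (simp add: Suc_diff_le)
      then show ?thesis using True Suc.prems by (intro Suc.IH) auto
    qed (simp add: binomial_eq_0)
    have "Suc k choose t \<le> (\<Sum>m\<in>{2,3}. tuple_count k (n div m))"
      using 2 3 Suc by simp
    also have "\<dots> \<le> tuple_count (Suc k) n"
      unfolding tuple_count.simps by (rule sum_mono2) (use order_trans[OF mult_le_mono2[OF pos(2), of 3] n] in auto)
    finally show ?thesis .
  qed
qed simp

lemma sum_inverse_le_ln: "n \<ge> 1 \<Longrightarrow> (\<Sum>m = 2..n. 1 / real m) \<le> ln n"
proof (induction n rule: nat_induct_at_least)
  case (Suc n)
  have "ln (real n / real (Suc n)) \<le> real n / real (Suc n) - 1"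
    by (rule ln_le_minus_one) (use Suc in auto)
  also have "\<dots> = - (1 / real (Suc n))" by (simp add: field_simps)
  also have "ln (real n / real (Suc n)) = ln n - ln (Suc n)"
    using Suc by (subst ln_div) auto
  finally show ?case using Suc by (simp del: of_nat_Suc)
qed simp

text \<open>Each further factor m costs a sum of 1/m, hence one logarithm. It is taken at a fixed N,
  so that the induction hypothesis gives the same power for all quotients
  \<open>n div m\<close>.\<close>

lemma tuple_count_le_ln:
  "n \<le> N \<Longrightarrow> real (tuple_count (Suc k) n) \<le> real n * ln (real N) ^ k"
proof (induction k arbitrary: n)
  case 0
  then show ?case by (simp add: tuple_count_1 del: tuple_count.simps)
next
  case (Suc k)
  show ?case
  proof (cases "n = 0")
    case False
    then have N: "1 \<le> n" "1 \<le> N" using Suc.prems by auto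
    have "real (tuple_count (Suc (Suc k)) n) = (\<Sum>m = 2..n. real (tuple_count (Suc k) (n div m)))"
      by (subst tuple_count.simps(2)) (simp del: tuple_count.simps)
    also have "\<dots> \<le> (\<Sum>m = 2..n. real n / real m * ln (real N) ^ k)"
    proof (rule sum_mono)
      fix m assume "m \<in> {2..n}"
      have "real (tuple_count (Suc k) (n div m)) \<le> real (n div m) * ln (real N) ^ k"
        by (rule Suc.IH) (use Suc.prems div_le_dividend le_trans in blast)
      also have "\<dots> \<le> real n / real m * ln (real N) ^ k"
        by (intro mult_right_mono of_nat_div_le_of_nat) (use N in auto)
      finally show "real (tuple_count (Suc k) (n div m)) \<le> real n / real m * ln (real N) ^ k" .
    qed
    also have "\<dots> = real n * ln (real N) ^ k * (\<Sum>m = 2..n. 1 / real m)"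
      by (simp add: sum_distrib_left)
    also have "\<dots> \<le> real n * ln (real N) ^ k * ln (real N)"
    proof (rule mult_left_mono)
      have "(\<Sum>m = 2..n. 1 / real m) \<le> ln (real n)" by (rule sum_inverse_le_ln) (rule N)
      also have "\<dots> \<le> ln (real N)" using N Suc.prems by simp
      finally show "(\<Sum>m = 2..n. 1 / real m) \<le> ln (real N)" .
    qed (use N in auto)
    finally show ?thesis by (simp add: mult_ac)
  qed simp
qed

section \<open>Stable polynomials\<close>

text \<open>This is the part of the Routh--Hurwitz criterion that involves the four lowest
  coefficients.\<close>

lemma stable_poly_coeffs:
  fixes q :: "real poly"
  assumes "lead_coeff q > 0"
    and "\<And>z. poly (map_poly complex_of_real q) z = 0 \<Longrightarrow> Re z \<le> 0"
  shows "(\<forall>i. coeff q i \<ge> 0) \<and> coeff q 0 * coeff q 3 \<le> coeff q 1 * coeff q 2"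
  using assms
proof (induction "degree q" arbitrary: q rule: less_induct)
  case less
  interpret of_real_poly_hom: map_poly_inj_idom_hom complex_of_real ..
  have q0: "q \<noteq> 0" using less.prems by auto
  show ?case
  proof (cases "degree q = 0")
    case True
    then obtain c where "q = [:c:]" by (meson degree_eq_zeroE)
    with less.prems show ?thesis by (auto simp: coeff_pCons split: nat.split)
  next
    case False
    then have "\<not> constant (poly (map_poly complex_of_real q))"
      by (simp add: constant_degree)
    then obtain z where z: "poly (map_poly complex_of_real q) z = 0"
      using fundamental_theorem_of_algebra by blast
    then have re: "Re z \<le> 0" by (rule less.prems)
    \<comment> \<open>A real root splits off x + a, a nonreal one together with its conjugate splits
      off x^2 + b x + c, with a, b, c \<ge> 0. The quotient p is again stable.\<close>
    show ?thesis
    proof (cases "Im z = 0")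
      case True
      then have "z = complex_of_real (Re z)" by (simp add: complex_eq_iff)
      then have "poly q (Re z) = 0" using z by (metis of_real_eq_0_iff of_real_hom.poly_map_poly)
      then obtain p where q: "q = [:- Re z, 1:] * p" using poly_eq_0_iff_dvd by (metis dvdE)
      define a where "a = - Re z"
      have a: "a \<ge> 0" "q = [:a, 1:] * p" using re q by (auto simp: a_def)
      have "p \<noteq> 0" using q0 a by auto
      then have "degree p < degree q" "lead_coeff p = lead_coeff q"
        unfolding a(2) lead_coeff_mult by (simp_all add: degree_mult_eq del: mult_pCons_left)
      then have "degree p < degree q" "lead_coeff p > 0" using less.prems(1) by simp_all
      moreover have "Re w \<le> 0" if "poly (map_poly complex_of_real p) w = 0" for w
        by (rule less.prems) (simp add: a that hom_distribs)
      ultimately have IH: "coeff p i \<ge> 0" "coeff p 0 * coeff p 3 \<le> coeff p 1 * coeff p 2" for i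
        using less.hyps by blast+
      have c: "coeff q i = a * coeff p i + (if i = 0 then 0 else coeff p (i - 1))" for i
        by (simp add: a coeff_pCons split: nat.split)
      \<comment> \<open>The mixed terms cancel and only nonnegative ones remain; this is where the
        nonnegativity of the coefficients enters the induction.\<close>
      have "coeff q 1 * coeff q 2 - coeff q 0 * coeff q 3 =
        a\<^sup>2 * (coeff p 1 * coeff p 2 - coeff p 0 * coeff p 3) + a * (coeff p 1)\<^sup>2 + coeff p 0 * coeff p 1"
        by (simp add: c algebra_simps power2_eq_square)
      also have "\<dots> \<ge> 0" using IH a by simp
      finally show ?thesis using IH a c by simp
    next
      case False
      define b c where "b = - 2 * Re z" and "c = (cmod z)\<^sup>2"
      have bc: "b \<ge> 0" "c \<ge> 0" using re by (auto simp: b_def c_def)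
      define d where "d = [:c, b, 1:]"
      have degd: "degree d = 2" "d \<noteq> 0" by (simp_all add: d_def)
      have dz: "poly (map_poly complex_of_real d) z = 0"
        unfolding d_def b_def c_def cmod_power2
        by (simp add: complex_eq_iff algebra_simps power2_eq_square)
      \<comment> \<open>The remainder u + v x has real coefficients and vanishes at the nonreal z:
        the imaginary part gives v = 0, then u = 0.\<close>
      have "q mod d = 0"
      proof -
        have "degree (q mod d) < 2 \<or> q mod d = 0"
          using degree_mod_less[of d q] degd by auto
        then have deg: "coeff (q mod d) i = 0" if "i > 1" for i
          using that by (auto intro: coeff_eq_0)
        define u v where "u = coeff (q mod d) 0" and "v = coeff (q mod d) 1"
        have uv: "q mod d = [:u, v:]"
          by (rule poly_eqI) (auto simp: u_def v_def coeff_pCons deg split: nat.split)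
        have "q = d * (q div d) + q mod d" by simp
        then have "map_poly complex_of_real q = map_poly complex_of_real d * map_poly complex_of_real (q div d) + map_poly complex_of_real (q mod d)"
          by (metis of_real_poly_hom.hom_add of_real_poly_hom.hom_mult)
        then have "poly (map_poly complex_of_real (q mod d)) z = 0" using z dz by simp
        then have "complex_of_real u + z * complex_of_real v = 0"
          by (simp add: uv of_real_hom.map_poly_pCons_hom)
        then have "u = 0 \<and> v = 0" using False by (auto simp: complex_eq_iff)
        then show ?thesis by (simp add: uv)
      qed
      then obtain p where a: "q = d * p" by (metis dvdE mod_0_imp_dvd)
      have "p \<noteq> 0" using q0 a by auto
      then have "degree p < degree q" "lead_coeff p = lead_coeff q"
        unfolding a d_def lead_coeff_mult by (simp_all add: degree_mult_eq del: mult_pCons_left)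
      then have "degree p < degree q" "lead_coeff p > 0" using less.prems(1) by simp_all
      moreover have "Re w \<le> 0" if "poly (map_poly complex_of_real p) w = 0" for w
        by (rule less.prems) (simp add: a that hom_distribs)
      ultimately have IH: "coeff p i \<ge> 0" "coeff p 0 * coeff p 3 \<le> coeff p 1 * coeff p 2" for i
        using less.hyps by blast+
      have c: "coeff q i = c * coeff p i + (if i = 0 then 0 else b * coeff p (i - 1))
          + (if i < 2 then 0 else coeff p (i - 2))" for i
        by (auto simp: a d_def coeff_pCons split: nat.split)
      have "coeff q 1 * coeff q 2 - coeff q 0 * coeff q 3 =
        c\<^sup>2 * (coeff p 1 * coeff p 2 - coeff p 0 * coeff p 3) + c * b * (coeff p 1)\<^sup>2
         + b\<^sup>2 * coeff p 0 * coeff p 1 + b * (coeff p 0)\<^sup>2"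
        by (simp add: c algebra_simps power2_eq_square)
      also have "\<dots> \<ge> 0" using IH bc by simp
      finally show ?thesis using IH bc c by simp
    qed
  qed
qed

section \<open>The characteristic polynomial\<close>

text \<open>The ring is left open: the real version serves for sign changes and stability, the
  complex one for eigenvalues.\<close>

definition redheffer_poly :: "nat \<Rightarrow> nat \<Rightarrow> 'a::comm_ring_1 poly" where
  "redheffer_poly r n = monom 1 (Suc r) - (\<Sum>k = 1..r. monom (of_nat (tuple_count k n)) (r - k))"

text \<open>With \<open>x = \<lambda> - 1\<close>, the vector with first entry \<open>x\<^sup>r\<close> and \<open>i\<close>-th entry
  \<open>count_sum x r (n div i)\<close> for \<open>i \<ge> 2\<close> solves all the eigenvector equations but the first one.\<close>

definition count_sum :: "'a::comm_ring_1 \<Rightarrow> nat \<Rightarrow> nat \<Rightarrow> 'a" where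
  "count_sum x r n = (\<Sum>k<r. of_nat (tuple_count k n) * x ^ (r - 1 - k))"

lemma sum_count_sum_div:
  "(\<Sum>m = 2..n. count_sum x r (n div m)) = (\<Sum>k<r. of_nat (tuple_count (Suc k) n) * x ^ (r - 1 - k))"
  unfolding count_sum_def by (subst sum.swap) (simp add: sum_distrib_right)

text \<open>Multiplication by x raises the exponents, while fixing the first factor shifts k by one.
  The boundary terms are x^r, from the empty tuple, and the term k = r, which vanishes because n <
  2^r.\<close>

lemma count_sum_rec:
  assumes "r > 0" "0 < n" "n < 2 ^ r"
  shows "x * count_sum x r n = x ^ r + (\<Sum>m = 2..n. count_sum x r (n div m))"
proof -
  let ?f = "\<lambda>k. of_nat (tuple_count k n) * x ^ (r - k)"
  have "x * count_sum x r n = (\<Sum>k<r. ?f k)"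
    unfolding count_sum_def sum_distrib_left
  proof (rule sum.cong)
    fix k assume "k \<in> {..<r}"
    then have "r - k = Suc (r - 1 - k)" by auto
    then show "x * (of_nat (tuple_count k n) * x ^ (r - 1 - k)) = ?f k" by (simp add: mult_ac)
  qed simp
  also have "\<dots> = (\<Sum>k<Suc r. ?f k)" using tuple_count_eq_0[OF assms(3)] by simp
  also have "\<dots> = ?f 0 + (\<Sum>k<r. ?f (Suc k))" by (rule sum.lessThan_Suc_shift)
  also have "\<dots> = x ^ r + (\<Sum>m = 2..n. count_sum x r (n div m))"
    using assms by (simp add: sum_count_sum_div del: tuple_count.simps(2))
  finally show ?thesis .
qed

lemma poly_redheffer_poly:
  "poly (redheffer_poly r n) x = x ^ Suc r - (\<Sum>k = 1..r. of_nat (tuple_count k n) * x ^ (r - k))"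
  by (simp add: redheffer_poly_def poly_monom poly_sum)

text \<open>This is the form in which the polynomial arises from the first row of the matrix product
  below; composing with \<open>[:-1, 1:]\<close> substitutes x = \<lambda> - 1.\<close>

lemma pcompose_redheffer_poly:
  "pcompose (redheffer_poly r n) p = p ^ Suc r - (\<Sum>m = 2..n. count_sum p r (n div m))"
proof -
  have "pcompose (monom c k) p = [:c:] * p ^ k" for c :: 'a and k
    by (induction k) (simp_all add: monom_0 monom_Suc pcompose_pCons)
  then have "pcompose (redheffer_poly r n) p = p ^ Suc r - (\<Sum>k = 1..r. of_nat (tuple_count k n) * p ^ (r - k))"
    by (simp add: redheffer_poly_def pcompose_diff pcompose_sum of_nat_poly)
  also have "(\<Sum>k = 1..r. of_nat (tuple_count k n) * p ^ (r - k))
      = (\<Sum>k<r. of_nat (tuple_count (Suc k) n) * p ^ (r - 1 - k))"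
    by (rule sum.reindex_bij_witness[of _ Suc "\<lambda>k. k - 1"]) auto
  finally show ?thesis by (simp add: sum_count_sum_div)
qed

text \<open>The multiples of a are l = a * m, and \<open>n div (a * m) = n div a div m\<close>. So a
  matrix row that picks out multiples of a sees the same kind of sum for
  \<open>n div a\<close>.\<close>

lemma sum_multiples:
  fixes a n :: nat
  assumes "0 < a"
  shows "(\<Sum>l \<in> {l \<in> {1..n}. a dvd l}. f (n div l)) = (\<Sum>m = 1..n div a. f (n div a div m))"
proof (rule sum.reindex_bij_witness[of _ "\<lambda>m. a * m" "\<lambda>l. l div a"])
  show "a * m \<in> {l \<in> {1..n}. a dvd l}" if "m \<in> {1..n div a}" for m
    using that assms by (auto simp: less_eq_div_iff_mult_less_eq mult.commute Suc_le_eq)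
  show "l div a \<in> {1..n div a}" if "l \<in> {l \<in> {1..n}. a dvd l}" for l
    using that assms by (auto simp: div_le_mono Suc_le_eq div_greater_zero_iff dvd_imp_le)
  show "f (n div a div (l div a)) = f (n div l)" if "l \<in> {l \<in> {1..n}. a dvd l}" for l
    using that by (metis (no_types, lifting) div_mult2_eq dvd_mult_div_cancel mem_Collect_eq)
qed (use assms in auto)

text \<open>Let M be \<lambda> I - C_n and A the identity with first column replaced by v. Then M A
  is upper triangular with diagonal P(x), x, ..., x, where P is \<open>redheffer_poly r n\<close>,
  and det A = x^r. Powers of x stay on both sides to avoid a division.\<close>

lemma char_poly_redheffer:
  assumes "n > 0" "r > 0" "n < 2 ^ Suc r"
  shows "[:-1, 1:] ^ r * char_poly (redheffer n) = [:-1, 1:] ^ (n - 1) * pcompose (redheffer_poly r n) [:-1, 1:]"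
proof -
  define x :: "complex poly" where "x = [:-1, 1:]"
  define M where "M = char_poly_matrix (redheffer n)"
  define v where "v i = (if i = 0 then x ^ r else count_sum x r (n div Suc i))" for i
  define A where "A = mat n n (\<lambda>(i, j). if j = 0 then v i else if i = j then 1 else 0)"
  have M[simp]: "M \<in> carrier_mat n n" by (simp add: M_def redheffer_def)
  have A[simp]: "A \<in> carrier_mat n n" by (simp add: A_def)
  have Mij: "M $$ (i, j) = (if i = j then x + 1 else 0) - (if j = 0 \<or> Suc i dvd Suc j then 1 else 0)"
    if "i < n" "j < n" for i j
    using that by (auto simp: M_def char_poly_matrix_def redheffer_def x_def one_pCons)
  have MA: "(M * A) $$ (i, j) = (\<Sum>k<n. M $$ (i, k) * A $$ (k, j))" if "i < n" "j < n" for i j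
    using that M A by (auto simp: scalar_prod_def lessThan_atLeast0 simp del: M A)
  have MA1: "(M * A) $$ (i, j) = M $$ (i, j)" if "i < n" "j < n" "j \<noteq> 0" for i j
  proof -
    have "(M * A) $$ (i, j) = (\<Sum>k<n. if k = j then M $$ (i, k) else 0)"
      unfolding MA[OF that(1,2)] by (rule sum.cong) (use that in \<open>auto simp: A_def\<close>)
    then show ?thesis using that by simp
  qed
  have shift: "(\<Sum>k\<in>{..<n}-{0}. g (Suc k)) = (\<Sum>l = 2..n. g l)" for g :: "nat \<Rightarrow> complex poly"
    by (rule sum.reindex_bij_witness[of _ "\<lambda>l. l - 1" Suc]) auto
  have MA0: "(M * A) $$ (i, 0) = (M $$ (i, 0) * x ^ r + (\<Sum>k\<in>{..<n}-{0}. M $$ (i, k) * v k))"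
    if "i < n" for i
    unfolding MA[OF that assms(1)] using assms(1)
    by (subst sum.remove[of _ 0]) (auto simp: A_def v_def intro!: sum.cong)
  have MA00: "(M * A) $$ (0, 0) = pcompose (redheffer_poly r n) x"
  proof -
    have "(\<Sum>k\<in>{..<n}-{0}. M $$ (0, k) * v k) = (\<Sum>k\<in>{..<n}-{0}. - count_sum x r (n div Suc k))"
      by (rule sum.cong) (use assms(1) in \<open>auto simp: Mij v_def\<close>)
    also have "\<dots> = - (\<Sum>l = 2..n. count_sum x r (n div l))"
      by (simp only: sum_negf shift[of "\<lambda>l. count_sum x r (n div l)"])
    finally show ?thesis
      using assms(1) by (simp add: MA0 Mij pcompose_redheffer_poly)
  qed
  \<comment> \<open>This is \<open>count_sum_rec\<close> for \<open>n div Suc i\<close>, which is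
    below 2^r because \<open>Suc i\<close> is at least 2.\<close>
  have MAi0: "(M * A) $$ (i, 0) = 0" if i: "i < n" "i \<noteq> 0" for i
  proof -
    define q where "q = n div Suc i"
    have q: "0 < q" using i by (simp add: q_def div_greater_zero_iff)
    have "n div Suc i \<le> n div 2" using i by (intro div_le_mono2) auto
    also have "n div 2 < 2 ^ r" using assms by (simp add: less_mult_imp_div_less mult.commute)
    finally have q2: "q < 2 ^ r" by (simp add: q_def)
    have "(\<Sum>k\<in>{..<n}-{0}. M $$ (i, k) * v k)
        = (\<Sum>k\<in>{..<n}-{0}. (if k = i then (x + 1) * count_sum x r q else 0)
             - (if Suc i dvd Suc k then count_sum x r (n div Suc k) else 0))"
      by (rule sum.cong) (use i in \<open>auto simp: Mij v_def q_def algebra_simps\<close>)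
    also have "\<dots> = (x + 1) * count_sum x r q
        - (\<Sum>k\<in>{..<n}-{0}. if Suc i dvd Suc k then count_sum x r (n div Suc k) else 0)"
      unfolding sum_subtractf using i by simp
    also have "(\<Sum>k\<in>{..<n}-{0}. if Suc i dvd Suc k then count_sum x r (n div Suc k) else 0)
        = (\<Sum>l = 2..n. if Suc i dvd l then count_sum x r (n div l) else 0)"
      by (rule shift)
    \<comment> \<open>Starting from l = 1 adds nothing, since \<open>Suc i\<close> does not divide
      1.\<close>
    also have "\<dots> = (\<Sum>l \<in> {l \<in> {1..n}. Suc i dvd l}. count_sum x r (n div l))"
      using i by (intro sum.mono_neutral_cong) (auto simp: not_le Suc_le_eq le_eq_less_or_eq numeral_2_eq_2)
    also have "\<dots> = (\<Sum>m = 1..q. count_sum x r (q div m))"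
      unfolding q_def by (rule sum_multiples) simp
    also have "\<dots> = count_sum x r q + (\<Sum>m = 2..q. count_sum x r (q div m))"
      using q by (subst sum.atLeast_Suc_atMost) (auto simp: numeral_2_eq_2)
    also have "\<dots> = count_sum x r q + (x * count_sum x r q - x ^ r)"
      using count_sum_rec[OF assms(2) q q2, of x] by simp
    finally show ?thesis using i by (simp add: MA0 Mij algebra_simps)
  qed
  have n: "[0..<n] = 0 # [1..<n]" using assms(1) by (simp add: upt_rec)
  have "upper_triangular (M * A)"
  proof (rule upper_triangularI)
    fix i j assume ij: "j < i" "i < dim_row (M * A)"
    then have "i < n" "j < n" using carrier_matD[OF M] by auto
    then show "(M * A) $$ (i, j) = 0"
      using ij dvd_imp_le[of "Suc i" "Suc j"] by (cases "j = 0") (auto simp: MAi0 MA1 Mij)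
  qed
  then have "det (M * A) = prod_list (diag_mat (M * A))"
    by (rule det_upper_triangular) (rule mult_carrier_mat[OF M A])
  also have "\<dots> = (M * A) $$ (0, 0) * prod_list (map (\<lambda>i. (M * A) $$ (i, i)) [1..<n])"
    using carrier_matD[OF M] by (simp add: diag_mat_def n)
  also have "map (\<lambda>i. (M * A) $$ (i, i)) [1..<n] = map (\<lambda>i. x) [1..<n]"
    by (rule map_cong) (auto simp: MA1 Mij)
  finally have 1: "det (M * A) = pcompose (redheffer_poly r n) x * x ^ (n - 1)"
    by (simp add: MA00 map_replicate_const prod_list_replicate)
  have "det A = prod_list (diag_mat A)"
    by (rule det_lower_triangular[OF _ A]) (auto simp: A_def)
  also have "\<dots> = A $$ (0, 0) * prod_list (map (\<lambda>i. A $$ (i, i)) [1..<n])"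
    using carrier_matD[OF A] by (simp add: diag_mat_def n)
  also have "map (\<lambda>i. A $$ (i, i)) [1..<n] = map (\<lambda>i. 1) [1..<n]"
    by (rule map_cong) (auto simp: A_def)
  finally have 2: "det A = x ^ r"
    using assms(1) by (simp add: map_replicate_const prod_list_replicate A_def v_def)
  have "det (M * A) = det M * det A" by (rule det_mult[OF M A])
  then show ?thesis
    unfolding 1 2 by (simp add: M_def char_poly_def x_def mult.commute)
qed

section \<open>The large roots\<close>

text \<open>D_1(n) = n - 1 gives the main part x^2 - (n - 1); the remaining sum is the perturbation
  to be bounded for large x.\<close>

lemma poly_redheffer_poly_factored:
  fixes x :: "'a::field"
  assumes "x \<noteq> 0" "r > 0"
  shows "poly (redheffer_poly r n) x =
    x ^ (r - 1) * (x\<^sup>2 - of_nat (n - 1) - (\<Sum>k = 2..r. of_nat (tuple_count k n) / x ^ (k - 1)))"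
proof -
  have "(\<Sum>k = 1..r. of_nat (tuple_count k n) * x ^ (r - k))
      = (\<Sum>k = 1..r. x ^ (r - 1) * (of_nat (tuple_count k n) / x ^ (k - 1)))"
  proof (rule sum.cong)
    fix k assume "k \<in> {1..r}"
    then have "r - 1 = (r - k) + (k - 1)" by auto
    then have "x ^ (r - 1) = x ^ (r - k) * x ^ (k - 1)" by (metis power_add)
    then show "of_nat (tuple_count k n) * x ^ (r - k) = x ^ (r - 1) * (of_nat (tuple_count k n) / x ^ (k - 1))"
      using assms by simp
  qed simp
  also have "\<dots> = x ^ (r - 1) * (of_nat (n - 1) + (\<Sum>k = 2..r. of_nat (tuple_count k n) / x ^ (k - 1)))"
    unfolding sum_distrib_left[symmetric] using assms(2)
    by (subst sum.atLeast_Suc_atMost) (auto simp: tuple_count_1 numeral_2_eq_2 simp del: tuple_count.simps)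
  moreover have "x ^ Suc r = x ^ (r - 1) * x\<^sup>2"
    using assms(2) by (simp add: power_add[symmetric] flip: power_Suc)
  ultimately show ?thesis by (simp add: poly_redheffer_poly algebra_simps)
qed

text \<open>R is half the square root of n. From \<open>n \<le> 2 ^ r\<close> follows ln n \<le> r,
  and \<open>4 * real r ^ 3 < R\<close> keeps the perturbation at most R^2 outside the disc of
  radius R.\<close>

context
  fixes r n :: nat and R :: real
  assumes n_le: "n \<le> 2 ^ r" and n_eq: "real n = 4 * R\<^sup>2" and R_large: "4 * real r ^ 3 < R" and r_pos: "r > 0"
begin

lemma R_ge: "real r \<le> R" "4 * (real r)\<^sup>2 \<le> R" "4 < R"
proof -
  have r: "1 \<le> real r" using r_pos by simp
  then have "real r \<le> real r ^ 3" "(real r)\<^sup>2 \<le> real r ^ 3" "1 \<le> real r ^ 3"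
    using power_increasing[of 1 3 "real r"] by (auto intro: power_increasing)
  then show "real r \<le> R" "4 * (real r)\<^sup>2 \<le> R" "4 < R" using R_large r by linarith+
qed

lemma tuple_count_div_power_le:
  assumes "k \<ge> 2"
  shows "real (tuple_count k n) / R ^ (k - 1) \<le> 4 * R * r"
proof -
  note R = R_ge
  have n: "n > 0" using n_eq R(3) by (intro gr0I) auto
  have "real n \<le> 2 ^ r" using n_le by (metis of_nat_le_iff of_nat_numeral of_nat_power)
  then have "ln (real n) \<le> ln (2 ^ r)" using n by (subst ln_le_cancel_iff) auto
  also have "\<dots> \<le> real r" using ln_2_less_1 by (simp add: ln_realpow mult_left_le)
  finally have ln: "ln (real n) \<le> real r" .
  have "real (tuple_count (Suc (k - 1)) n) \<le> real n * ln (real n) ^ (k - 1)"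
    by (rule tuple_count_le_ln) simp
  also have "\<dots> \<le> real n * real r ^ (k - 1)"
    using ln n by (intro mult_left_mono power_mono) auto
  finally have "real (tuple_count k n) / R ^ (k - 1) \<le> real n * (real r / R) ^ (k - 1)"
    using assms R by (simp add: power_divide divide_right_mono)
  \<comment> \<open>As r / R \<le> 1, the worst case is k = 2.\<close>
  also have "\<dots> \<le> real n * (real r / R) ^ 1"
    using assms R by (intro mult_left_mono power_decreasing) (auto simp: field_simps)
  also have "\<dots> = 4 * R * r" using R by (simp add: n_eq power2_eq_square)
  finally show ?thesis .
qed

text \<open>The weights will be powers of R/x (size of the tail), differences of such powers
  (comparison of two roots), and powers times k - 1 (derivative).\<close>

lemma norm_weighted_tail_le:
  fixes a :: "nat \<Rightarrow> 'a::real_normed_field"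
  assumes a: "\<And>k. k \<in> {2..r} \<Longrightarrow> norm (a k) \<le> B" and "B \<ge> 0"
  shows "norm (\<Sum>k = 2..r. of_real (real (tuple_count k n) / R ^ (k - 1)) * a k) \<le> 4 * R * (real r)\<^sup>2 * B"
proof -
  have "norm (\<Sum>k = 2..r. of_real (real (tuple_count k n) / R ^ (k - 1)) * a k)
      \<le> of_nat (card {2..r}) * (4 * R * r * B)"
  proof (rule sum_norm_bound)
    fix k assume k: "k \<in> {2..r}"
    have "norm (of_real (real (tuple_count k n) / R ^ (k - 1)) * a k)
        = real (tuple_count k n) / R ^ (k - 1) * norm (a k)"
      using R_ge by (simp add: norm_mult norm_divide norm_power)
    also have "\<dots> \<le> 4 * R * r * B"
      using R_ge k a by (intro mult_mono tuple_count_div_power_le) auto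
    finally show "norm (of_real (real (tuple_count k n) / R ^ (k - 1)) * a k) \<le> 4 * R * r * B" .
  qed
  also have "\<dots> \<le> real r * (4 * R * r * B)"
    using assms(2) R_ge by (intro mult_right_mono) auto
  finally show ?thesis by (simp add: power2_eq_square mult_ac)
qed

lemma scaled_summand:
  fixes x :: "'a::real_normed_field"
  shows "of_nat m / x ^ j = of_real (real m / R ^ j) * (of_real R / x) ^ j"
  using R_ge by (simp add: power_divide)

lemma norm_tail_le:
  fixes x :: "'a::real_normed_field"
  assumes "R \<le> norm x"
  shows "norm (\<Sum>k = 2..r. of_nat (tuple_count k n) / x ^ (k - 1)) \<le> 4 * R * (real r)\<^sup>2"
proof -
  have "norm ((of_real R / x) ^ (k - 1)) \<le> 1" for k
    using assms R_ge by (auto simp: norm_power norm_divide divide_le_eq intro!: power_le_one)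
  then show ?thesis
    unfolding scaled_summand[of _ x] using norm_weighted_tail_le[of "\<lambda>k. (of_real R / x) ^ (k - 1)" 1] by simp
qed

text \<open>The main part is about -3 R^2 at modulus R + 2 and about 12 R^2 at 4 R, against a tail
  of at most R^2. As a and b have the same sign, the factors x^(r-1) do not affect the sign of the
  product.\<close>

lemma redheffer_poly_sign_change:
  assumes "\<bar>a\<bar> = R + 2" "\<bar>b\<bar> = 4 * R" "a * b > 0"
  shows "poly (redheffer_poly r n) a * poly (redheffer_poly r n) b < 0"
proof -
  define f where "f x = x\<^sup>2 - real (n - 1) - (\<Sum>k = 2..r. of_nat (tuple_count k n) / x ^ (k - 1))" for x
  have "n > 0" using n_eq R_ge by (intro gr0I) auto
  then have n1: "real (n - 1) = 4 * R\<^sup>2 - 1" using n_eq by simp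
  have R: "4 * R * (real r)\<^sup>2 \<le> R\<^sup>2" "4 * R < R\<^sup>2"
    using R_ge mult_left_mono[OF R_ge(2), of R] by (simp_all add: power2_eq_square mult_ac)
  have a2: "a\<^sup>2 = R\<^sup>2 + 4 * R + 4" "b\<^sup>2 = 16 * R\<^sup>2"
    using power2_abs[of a] power2_abs[of b] unfolding assms(1,2)
    by (simp_all add: power2_eq_square algebra_simps)
  have "f a < 0" using norm_tail_le[of a] R_ge R assms(1) unfolding f_def n1 a2 real_norm_def by linarith
  moreover have "f b > 0" using norm_tail_le[of b] R_ge R assms(2) unfolding f_def n1 a2 real_norm_def by linarith
  moreover have "a \<noteq> 0" "b \<noteq> 0" using assms(3) by auto
  then have "poly (redheffer_poly r n) a * poly (redheffer_poly r n) b = (a * b) ^ (r - 1) * (f a * f b)"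
    using r_pos by (simp add: poly_redheffer_poly_factored f_def power_mult_distrib)
  ultimately show ?thesis
    using assms(3) by (simp add: mult_pos_neg mult_neg_pos)
qed

text \<open>The margin 2 absorbs the shift \<lambda> = 1 + x: both eigenvalues have modulus above R
  + 1, while |x| < R gives |\<lambda>| < R + 1.\<close>

lemma redheffer_poly_real_roots:
  obtains u v :: real where "R + 2 < u" "v < - (R + 2)"
    "poly (redheffer_poly r n) u = 0" "poly (redheffer_poly r n) v = 0"
proof -
  have "poly (redheffer_poly r n) (R + 2) * poly (redheffer_poly r n) (4 * R) < 0"
    by (rule redheffer_poly_sign_change) (use R_ge in auto)
  then obtain u where "R + 2 < u" "poly (redheffer_poly r n) u = 0"
    using poly_IVT[of "R + 2" "4 * R" "redheffer_poly r n"] R_ge by auto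
  moreover have "poly (redheffer_poly r n) (- (R + 2)) * poly (redheffer_poly r n) (- (4 * R)) < 0"
    by (rule redheffer_poly_sign_change) (use R_ge in \<open>auto simp del: minus_add_distrib\<close>)
  then obtain v where "v < - (R + 2)" "poly (redheffer_poly r n) v = 0"
    using poly_IVT[of "- (4 * R)" "- (R + 2)" "redheffer_poly r n"] R_ge by (auto simp: mult.commute)
  ultimately show ?thesis using that by blast
qed

text \<open>Subtracting the equations x^2 = n - 1 + tail for the two roots leaves (z + w)(z - w) as
  a difference of tails. The tail is Lipschitz in R/x, so this is at most 4 r^3 |z - w|, and z - w
  cancels.\<close>

lemma large_roots_nearly_opposite:
  fixes z w :: complex
  assumes "poly (redheffer_poly r n) z = 0" "poly (redheffer_poly r n) w = 0" "R \<le> cmod z" "R \<le> cmod w" "z \<noteq> w"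
  shows "cmod (z + w) \<le> 4 * real r ^ 3"
proof -
  have nz: "z \<noteq> 0" "w \<noteq> 0" using assms R_ge by auto
  let ?c = "\<lambda>k. real (tuple_count k n) / R ^ (k - 1)"
  have root: "x\<^sup>2 = of_nat (n - 1) + (\<Sum>k = 2..r. of_real (?c k) * (of_real R / x) ^ (k - 1))"
    if "poly (redheffer_poly r n) x = 0" "x \<noteq> 0" for x :: complex
    using that poly_redheffer_poly_factored[of x r n] r_pos unfolding scaled_summand[of _ x]
    by (simp add: diff_diff_eq)
  let ?u = "of_real R / z" and ?v = "of_real R / w"
  have "z\<^sup>2 - w\<^sup>2 = (\<Sum>k = 2..r. of_real (?c k) * (?u ^ (k - 1) - ?v ^ (k - 1)))"
    using root[OF assms(1)] root[OF assms(2)] nz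
    by (simp add: sum_subtractf right_diff_distrib del: of_real_divide)
  also have "cmod \<dots> \<le> 4 * R * (real r)\<^sup>2 * (r * cmod (?u - ?v))"
  proof (rule norm_weighted_tail_le)
    fix k assume k: "k \<in> {2..r}"
    have "cmod (?u ^ (k - 1) - ?v ^ (k - 1)) \<le> real (k - 1) * cmod (?u - ?v)"
      by (rule norm_power_diff) (use assms R_ge in \<open>auto simp: norm_divide divide_le_eq\<close>)
    also have "\<dots> \<le> r * cmod (?u - ?v)" using k by (intro mult_right_mono) auto
    finally show "cmod (?u ^ (k - 1) - ?v ^ (k - 1)) \<le> r * cmod (?u - ?v)" .
  qed simp
  also have "?u - ?v = of_real R * (w - z) / (z * w)" using nz by (simp add: field_simps)
  also have "cmod \<dots> = R * cmod (z - w) / (cmod z * cmod w)"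
    using R_ge by (simp add: norm_mult norm_divide norm_minus_commute)
  also have "4 * R * (real r)\<^sup>2 * (r * (R * cmod (z - w) / (cmod z * cmod w)))
     \<le> 4 * R * (real r)\<^sup>2 * (r * (R * cmod (z - w) / (R * R)))"
    using assms R_ge by (intro mult_left_mono divide_left_mono mult_mono mult_pos_pos) auto
  also have "\<dots> = 4 * real r ^ 3 * cmod (z - w)"
    using R_ge by (simp add: power2_eq_square power3_eq_cube)
  also have "z\<^sup>2 - w\<^sup>2 = (z + w) * (z - w)" by (simp add: power2_eq_square algebra_simps)
  finally show ?thesis using assms(5) by (simp add: norm_mult)
qed

text \<open>At a multiple root z P'(z) - (r - 1) P(z) = 0, with P the polynomial in question. The
  multiplier r - 1 removes the dominant D_1 term and leaves 2 z^2 = - \<Sum> (k - 1) D_k(n) /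
  z^(k-1), whose right side is smaller than |z|^2 in modulus.\<close>

lemma large_root_simple:
  fixes z :: complex
  assumes "poly (redheffer_poly r n) z = 0" "R \<le> cmod z"
  shows "poly (pderiv (redheffer_poly r n)) z \<noteq> 0"
proof
  assume d: "poly (pderiv (redheffer_poly r n)) z = 0"
  have nz: "z \<noteq> 0" using assms R_ge by auto
  let ?D = "\<lambda>k. of_nat (tuple_count k n) :: complex"
  have "z * poly (pderiv (redheffer_poly r n)) z
      = of_nat (Suc r) * z ^ Suc r - (\<Sum>k = 1..r. of_nat (r - k) * ?D k * z ^ (r - k))"
  proof -
    have "z * poly (pderiv (monom (?D k) (r - k))) z = of_nat (r - k) * ?D k * z ^ (r - k)" for k
      by (cases "r - k") (auto simp: poly_monom pderiv_monom simp del: of_nat_Suc)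
    moreover have "z * poly (pderiv (monom 1 (Suc r))) z = of_nat (Suc r) * z ^ Suc r"
      by (simp add: poly_monom pderiv_monom del: of_nat_Suc)
    ultimately show ?thesis
      unfolding redheffer_poly_def pderiv_diff pderiv_sum poly_diff poly_sum right_diff_distrib sum_distrib_left
      by simp
  qed
  \<comment> \<open>The part with r - 1 is rewritten through P(z) = 0.\<close>
  also have "of_nat (Suc r) * z ^ Suc r = 2 * z ^ Suc r + of_nat (r - 1) * z ^ Suc r"
    using r_pos by (cases r) (auto simp: algebra_simps)
  finally have "2 * z ^ Suc r + (of_nat (r - 1) * z ^ Suc r - (\<Sum>k = 1..r. of_nat (r - k) * ?D k * z ^ (r - k))) = 0"
    unfolding d mult_zero_right add_diff_eq by (rule sym)
  moreover have "of_nat (r - 1) * z ^ Suc r = (\<Sum>k = 1..r. of_nat (r - 1) * (?D k * z ^ (r - k)))"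
    using assms(1) by (simp add: poly_redheffer_poly sum_distrib_left)
  ultimately have "2 * z ^ Suc r = - (\<Sum>k = 1..r. of_nat (r - 1) * (?D k * z ^ (r - k)) - of_nat (r - k) * ?D k * z ^ (r - k))"
    by (simp add: sum_subtractf add_eq_0_iff2)
  also have "(\<Sum>k = 1..r. of_nat (r - 1) * (?D k * z ^ (r - k)) - of_nat (r - k) * ?D k * z ^ (r - k))
      = (\<Sum>k = 1..r. z ^ (r - 1) * (?D k / z ^ (k - 1) * of_nat (k - 1)))"
  proof (rule sum.cong)
    fix k assume "k \<in> {1..r}"
    then have k: "r - 1 = (r - k) + (k - 1)" by auto
    then have "z ^ (r - 1) = z ^ (r - k) * z ^ (k - 1)" by (metis power_add)
    moreover have "(of_nat (r - 1) :: complex) = of_nat (r - k) + of_nat (k - 1)"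
      by (subst k) (rule of_nat_add)
    ultimately show "of_nat (r - 1) * (?D k * z ^ (r - k)) - of_nat (r - k) * ?D k * z ^ (r - k)
        = z ^ (r - 1) * (?D k / z ^ (k - 1) * of_nat (k - 1))"
      using nz by (simp add: algebra_simps)
  qed simp
  also have "\<dots> = z ^ (r - 1) * (\<Sum>k = 2..r. ?D k / z ^ (k - 1) * of_nat (k - 1))"
    unfolding sum_distrib_left[symmetric] using r_pos
    by (subst sum.atLeast_Suc_atMost) (auto simp: numeral_2_eq_2)
  also have "z ^ Suc r = z ^ (r - 1) * z\<^sup>2"
    using r_pos by (simp add: power_add[symmetric] flip: power_Suc)
  finally have "z ^ (r - 1) * (2 * z\<^sup>2) = z ^ (r - 1) * - (\<Sum>k = 2..r. ?D k / z ^ (k - 1) * of_nat (k - 1))"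
    by (simp only: mult_ac mult_minus_right)
  then have "2 * z\<^sup>2 = - (\<Sum>k = 2..r. ?D k / z ^ (k - 1) * of_nat (k - 1))"
    by (rule mult_left_cancel[THEN iffD1, OF power_not_zero[OF nz]])
  then have "2 * z\<^sup>2 = - (\<Sum>k = 2..r. of_real (real (tuple_count k n) / R ^ (k - 1)) *
      ((of_real R / z) ^ (k - 1) * of_nat (k - 1)))"
    by (simp only: scaled_summand[of _ z] mult.assoc)
  then have "cmod (2 * z\<^sup>2) = cmod (\<Sum>k = 2..r. of_real (real (tuple_count k n) / R ^ (k - 1)) *
      ((of_real R / z) ^ (k - 1) * of_nat (k - 1)))"
    by (simp only: norm_minus_cancel)
  also have "\<dots> \<le> 4 * R * (real r)\<^sup>2 * r"
  proof (rule norm_weighted_tail_le)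
    fix k assume k: "k \<in> {2..r}"
    have "cmod (of_real R / z) \<le> 1"
      using assms R_ge nz by (simp add: norm_divide)
    then have "cmod (of_real R / z) ^ (k - 1) * real (k - 1) \<le> 1 * real r"
      using k by (intro mult_mono power_le_one) auto
    then show "cmod ((of_real R / z) ^ (k - 1) * of_nat (k - 1)) \<le> real r"
      by (simp add: norm_mult norm_power)
  qed simp
  also have "\<dots> = R * (4 * real r ^ 3)" by (simp add: power2_eq_square power3_eq_cube)
  also have "\<dots> < R * R" using R_large R_ge by simp
  also have "\<dots> \<le> (cmod z)\<^sup>2" using assms(2) R_ge by (simp add: power2_eq_square mult_mono)
  finally show False by (simp add: norm_mult norm_power)
qed

end

section \<open>Roots with positive real part\<close>

lemma coeff_redheffer_poly:
  "coeff (redheffer_poly r n) i = (if i = Suc r then 1 else 0) - (if i < r then of_nat (tuple_count (r - i) n) else 0)"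
proof -
  have "(\<Sum>k = 1..r. coeff (monom (of_nat (tuple_count k n)) (r - k)) i)
      = (\<Sum>k = 1..r. if k = r - i \<and> i < r then of_nat (tuple_count k n) else (0 :: 'a))"
    by (rule sum.cong) auto
  also have "\<dots> = (if i < r then of_nat (tuple_count (r - i) n) else 0)"
    by auto
  finally show ?thesis by (auto simp: redheffer_poly_def coeff_sum)
qed

lemma lead_coeff_redheffer_poly: "lead_coeff (redheffer_poly r n :: 'a::comm_ring_1 poly) = 1"
proof -
  have "degree (redheffer_poly r n :: 'a poly) = Suc r"
    by (rule antisym[OF degree_le le_degree]) (auto simp: coeff_redheffer_poly)
  then show ?thesis by (simp add: coeff_redheffer_poly)
qed

lemma map_poly_redheffer_poly: "map_poly complex_of_real (redheffer_poly r n) = redheffer_poly r n"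
  by (rule poly_eqI) (simp add: coeff_map_poly coeff_redheffer_poly)

text \<open>Otherwise the cofactor q of x - u is stable and satisfies the Hurwitz inequality. Its
  low coefficients are controlled by the counts D_(r-i)(n), so that inequality would contradict
  \<open>ineq\<close>.\<close>

lemma redheffer_poly_unstable:
  fixes u :: real
  assumes root: "poly (redheffer_poly r n) u = 0" and "u \<ge> 1"
    and simple: "poly (pderiv (redheffer_poly r n)) (complex_of_real u) \<noteq> 0"
    and "r > 3"
    and ineq: "(tuple_count (r - 1) n + tuple_count r n) *
      (tuple_count (r - 2) n + tuple_count (r - 1) n + tuple_count r n) < tuple_count r n * tuple_count (r - 3) n"
  shows "\<exists>z. poly (redheffer_poly r n) z = 0 \<and> z \<noteq> complex_of_real u \<and> Re z > 0"
proof (rule ccontr)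
  assume "\<not> ?thesis"
  then have le: "Re z \<le> 0" if "poly (redheffer_poly r n) z = 0" "z \<noteq> complex_of_real u" for z
    using that by (meson not_le)
  interpret of_real_poly_hom: map_poly_inj_idom_hom complex_of_real ..
  obtain q where q: "redheffer_poly r n = [:- u, 1:] * q"
    using root poly_eq_0_iff_dvd by (metis dvdE)
  then have qc: "redheffer_poly r n = [:- complex_of_real u, 1:] * map_poly complex_of_real q"
    by (subst map_poly_redheffer_poly[symmetric]) (simp add: hom_distribs)
  have "lead_coeff q > 0"
    using lead_coeff_redheffer_poly[of r n, where 'a=real] unfolding q lead_coeff_mult by simp
  moreover have "Re z \<le> 0" if z: "poly (map_poly complex_of_real q) z = 0" for z
  proof (rule le)
    show "poly (redheffer_poly r n) z = 0" using z by (simp add: qc)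
    \<comment> \<open>A simple root u of the product is not a root of q.\<close>
    show "z \<noteq> complex_of_real u"
      using z simple unfolding qc pderiv_mult by (auto simp: pderiv_pCons)
  qed
  ultimately have st: "coeff q i \<ge> 0" "coeff q 0 * coeff q 3 \<le> coeff q 1 * coeff q 2" for i
    using stable_poly_coeffs by blast+
  \<comment> \<open>For i < r the i-th coefficient of (x - u) q is -d i, which gives d i = u q_i -
    q_(i-1).\<close>
  define d where "d i = real (tuple_count (r - i) n)" for i
  have d: "d i = u * coeff q i - (if i = 0 then 0 else coeff q (i - 1))" if "i < r" for i
    using coeff_redheffer_poly[of r n i, where 'a=real] that unfolding q by (auto simp: d_def coeff_pCons split: nat.splits)
  have d0: "d 0 = u * coeff q 0" and d1: "d 1 = u * coeff q 1 - coeff q 0"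
    and d2: "d 2 = u * coeff q 2 - coeff q 1" and d3: "d 3 = u * coeff q 3 - coeff q 2"
    using d[of 0] d[of 1] d[of 2] d[of 3] assms(4) by auto
  have q_le: "coeff q i \<le> u * coeff q i" for i
    using mult_right_mono[OF assms(2) st(1)[of i]] by simp
  \<comment> \<open>Since q_2 \<ge> 0, d 3 \<le> u q_3. Conversely u \<ge> 1 gives u q_1 = d 1 + q_0
    \<le> d 1 + d 0 and then u q_2 \<le> d 2 + d 1 + d 0.\<close>
  have "d 0 * d 3 \<le> (u * coeff q 0) * (u * coeff q 3)"
    using st(1) assms(2) by (simp add: d0 d3 mult_left_mono)
  also have "\<dots> = u\<^sup>2 * (coeff q 0 * coeff q 3)" by (simp add: power2_eq_square)
  also have "\<dots> \<le> u\<^sup>2 * (coeff q 1 * coeff q 2)"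
    by (rule mult_left_mono[OF st(2)]) simp
  also have "\<dots> = (u * coeff q 1) * (u * coeff q 2)" by (simp add: power2_eq_square)
  also have "\<dots> \<le> (d 1 + d 0) * (d 2 + d 1 + d 0)"
  proof (rule mult_mono)
    show "u * coeff q 1 \<le> d 1 + d 0" "u * coeff q 2 \<le> d 2 + d 1 + d 0"
      unfolding d0 d1 d2 using q_le[of 0] q_le[of 1] st(1)[of 0] by linarith+
    then show "0 \<le> d 1 + d 0" using order_trans[OF st(1)[of 1] q_le] by linarith
    show "0 \<le> u * coeff q 2" using order_trans[OF st(1) q_le] .
  qed
  finally have "real (tuple_count r n * tuple_count (r - 3) n) \<le>
      real ((tuple_count (r - 1) n + tuple_count r n) * (tuple_count (r - 2) n + tuple_count (r - 1) n + tuple_count r n))"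
    by (simp add: d_def)
  with ineq show False by (simp only: of_nat_le_iff)
qed

section \<open>Multiplicities of the nontrivial eigenvalues and the large pair\<close>

lemma order_char_poly_redheffer:
  assumes "n > 0" "r > 0" "n < 2 ^ Suc r" "z \<noteq> 0"
  shows "order (1 + z) (char_poly (redheffer n)) = order (1 + z) (pcompose (redheffer_poly r n) [:-1, 1:])"
proof -
  have "redheffer_poly r n \<noteq> (0 :: complex poly)"
    using lead_coeff_redheffer_poly[of r n, where 'a=complex] by force
  then have nz: "pcompose (redheffer_poly r n) [:-1, 1 :: complex:] \<noteq> 0"
    by (simp add: pcompose_eq_0_iff)
  have ord: "order (1 + z) ([:-1, 1:] ^ m * p) = order (1 + z) p" if "p \<noteq> 0" for m p
  proof -
    have "order (1 + z) ([:-1, 1:] ^ m) = 0"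
      using assms(4) by (intro order_0I) auto
    then show ?thesis using that by (subst order_mult) auto
  qed
  have "char_poly (redheffer n) \<noteq> 0"
    using char_poly_redheffer[OF assms(1-3)] nz by (metis mult_zero_right mult_eq_0_iff pCons_eq_0_iff power_not_zero zero_neq_one)
  then show ?thesis
    using ord nz char_poly_redheffer[OF assms(1-3)] by metis
qed

lemma count_nontrivial_eigenvalues:
  assumes "n > 0" "r > 0" "n < 2 ^ Suc r" "z \<noteq> 0"
  shows "count (nontrivial_eigenvalues n) (1 + z) = order (1 + z) (pcompose (redheffer_poly r n) [:-1, 1:])"
proof -
  have "char_poly (redheffer n) \<noteq> 0"
    using degree_monic_char_poly[of "redheffer n" n] by (force simp: redheffer_def)
  then show ?thesis
    using assms by (simp add: nontrivial_eigenvalues_def order_char_poly_redheffer)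
qed

text \<open>At \<mu> = 1 both sides fail: \<open>2 ^ r \<le> n\<close> admits the tuple of r twos,
  so the constant coefficient -D_r(n) is nonzero.\<close>

lemma nontrivial_eigenvalue_iff:
  assumes "n > 0" "r > 0" "2 ^ r \<le> n" "n < 2 ^ Suc r"
  shows "\<mu> \<in># nontrivial_eigenvalues n \<longleftrightarrow> poly (redheffer_poly r n) (\<mu> - 1) = 0"
proof (cases "\<mu> = 1")
  case True
  have "1 \<le> tuple_count r n"
    using binomial_le_tuple_count[of 0 r n] assms(3) by simp
  then have "poly (redheffer_poly r n) (0 :: complex) \<noteq> 0"
    using assms(2) by (simp add: poly_0_coeff_0 coeff_redheffer_poly)
  then show ?thesis using True by (simp add: nontrivial_eigenvalues_def)
next
  case False
  have "redheffer_poly r n \<noteq> (0 :: complex poly)"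
    using lead_coeff_redheffer_poly[of r n, where 'a=complex] by force
  then have nz: "pcompose (redheffer_poly r n) [:-1, 1 :: complex:] \<noteq> 0"
    by (simp add: pcompose_eq_0_iff)
  have "\<mu> \<in># nontrivial_eigenvalues n \<longleftrightarrow> order \<mu> (pcompose (redheffer_poly r n) [:-1, 1:]) \<noteq> 0"
    using count_nontrivial_eigenvalues[of n r "\<mu> - 1"] assms False
    by (simp flip: count_greater_zero_iff)
  also have "\<dots> \<longleftrightarrow> poly (redheffer_poly r n) (\<mu> - 1) = 0"
    using nz order_root[of "pcompose (redheffer_poly r n) [:-1, 1:]" \<mu>] by (simp add: poly_pcompose)
  finally show ?thesis .
qed

text \<open>Multiplicity one matters because the large pair is removed from a multiset: a second
  copy would stay behind among the small eigenvalues.\<close>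

lemma count_simple_nontrivial_eigenvalue:
  assumes "n > 0" "r > 0" "n < 2 ^ Suc r" "z \<noteq> 0"
    and root: "poly (redheffer_poly r n) z = 0" and simple: "poly (pderiv (redheffer_poly r n)) z \<noteq> 0"
  shows "count (nontrivial_eigenvalues n) (1 + z) = 1"
proof -
  let ?p = "pcompose (redheffer_poly r n) [:-1, 1 :: complex:]"
  have d: "poly (pderiv ?p) (1 + z) \<noteq> 0"
    using simple by (simp add: pderiv_pcompose poly_pcompose pderiv_pCons)
  then have "?p \<noteq> 0" by auto
  then have "order (1 + z) ?p = Suc (order (1 + z) (pderiv ?p))"
    by (rule order_pderiv) (simp add: poly_pcompose root)
  also have "order (1 + z) (pderiv ?p) = 0" using d by (rule order_0I)
  finally show ?thesis using count_nontrivial_eigenvalues[OF assms(1-4)] by simp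
qed

text \<open>A third root of modulus at least R would be nearly opposite to both u and v, forcing u -
  v \<le> 8 r^3 < 2 R, whereas u - v > 2 R + 4.\<close>

lemma large_pair_two_power:
  fixes R :: real
  assumes n: "n = 2 ^ r" "real n = 4 * R\<^sup>2" and R: "4 * real r ^ 3 < R" and r: "r > 0"
  obtains u v :: real where "u > 1" "v < 0"
    "poly (redheffer_poly r n) u = 0" "poly (pderiv (redheffer_poly r n)) (complex_of_real u) \<noteq> 0"
    "large_eigenvalue_pair n (1 + of_real u) (1 + of_real v)"
    "\<And>z. poly (redheffer_poly r n) z = 0 \<Longrightarrow> z \<noteq> of_real u \<Longrightarrow> z \<noteq> of_real v \<Longrightarrow>
      1 + z \<in># nontrivial_eigenvalues n - {#1 + of_real u, 1 + of_real v#}"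
proof -
  note hyps = eq_refl[OF n(1)] n(2) R r
  note R4 = R_ge(3)[OF hyps]
  have n': "n > 0" "2 ^ r \<le> n" "n < 2 ^ Suc r" using n(1) by auto
  obtain u v :: real where uv: "R + 2 < u" "v < - (R + 2)"
    and ru: "poly (redheffer_poly r n) u = 0" and rv: "poly (redheffer_poly r n) v = 0"
    using redheffer_poly_real_roots[OF hyps] by blast
  have cu: "poly (redheffer_poly r n) (complex_of_real u) = 0" and cv: "poly (redheffer_poly r n) (complex_of_real v) = 0"
    unfolding map_poly_redheffer_poly[symmetric] using ru rv by simp_all
  have su: "poly (pderiv (redheffer_poly r n)) (complex_of_real u) \<noteq> 0"
    and sv: "poly (pderiv (redheffer_poly r n)) (complex_of_real v) \<noteq> 0"
    using large_root_simple[OF hyps cu] large_root_simple[OF hyps cv] uv R4 by auto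
  let ?a = "1 + complex_of_real u" and ?b = "1 + complex_of_real v"
  let ?E = "nontrivial_eigenvalues n"
  have ab: "?a \<noteq> ?b" using uv R4 by simp
  have ca: "count ?E ?a = 1" and cb: "count ?E ?b = 1"
    using count_simple_nontrivial_eigenvalue[OF n'(1) r n'(3) _ cu su]
      count_simple_nontrivial_eigenvalue[OF n'(1) r n'(3) _ cv sv] uv R4 by auto
  have count: "count (?E - {#?a, ?b#}) \<mu> = (if \<mu> = ?a \<or> \<mu> = ?b then 0 else count ?E \<mu>)" for \<mu>
    using ab ca cb by simp
  have "cmod \<mu> < cmod ?a \<and> cmod \<mu> < cmod ?b" if \<mu>: "\<mu> \<in># ?E - {#?a, ?b#}" for \<mu>
  proof -
    define z where "z = \<mu> - 1"
    have "\<mu> \<in># ?E" "\<mu> \<noteq> ?a" "\<mu> \<noteq> ?b"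
      using \<mu> count[of \<mu>] by (auto simp flip: count_greater_zero_iff split: if_splits)
    then have z: "poly (redheffer_poly r n) z = 0" "z \<noteq> of_real u" "z \<noteq> of_real v"
      using nontrivial_eigenvalue_iff[OF n'(1) r n'(2,3)] by (auto simp: z_def diff_eq_eq add.commute)
    have "cmod z < R"
    proof (rule ccontr)
      assume "\<not> cmod z < R"
      then have "cmod (z + of_real u) \<le> 4 * real r ^ 3" "cmod (z + of_real v) \<le> 4 * real r ^ 3"
        using z uv R4 by (auto intro!: large_roots_nearly_opposite[OF hyps] cu cv)
      then have "cmod ((z + of_real u) - (z + of_real v)) < 2 * R"
        using norm_triangle_ineq4[of "z + of_real u" "z + of_real v"] R by linarith
      also have "(z + of_real u) - (z + of_real v) = complex_of_real (u - v)" by simp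
      finally show False using uv R4 unfolding norm_of_real by linarith
    qed
    then have "cmod \<mu> < 1 + R"
      using norm_triangle_ineq[of 1 z] by (simp add: z_def)
    moreover have "cmod ?a = \<bar>1 + u\<bar>" "cmod ?b = \<bar>1 + v\<bar>"
      by (metis norm_of_real of_real_1 of_real_add)+
    ultimately show ?thesis using uv by linarith
  qed
  moreover have "{#?a, ?b#} \<subseteq># ?E"
    using ab ca cb by (auto simp: subseteq_mset_def simp flip: count_greater_zero_iff)
  ultimately have "large_eigenvalue_pair n ?a ?b"
    by (simp add: large_eigenvalue_pair_def)
  moreover have "1 + z \<in># ?E - {#?a, ?b#}"
    if "poly (redheffer_poly r n) z = 0" "z \<noteq> of_real u" "z \<noteq> of_real v" for z
  proof -
    have "1 + z \<in># ?E"
      using nontrivial_eigenvalue_iff[OF n'(1) r n'(2,3)] that by simp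
    then show ?thesis using count[of "1 + z"] that by (simp flip: count_greater_zero_iff)
  qed
  ultimately show ?thesis
    using that[of u v] uv R4 ru su by simp
qed

section \<open>Growth comparison and conclusion\<close>

text \<open>The ratios of n to 2^(r-1) and 2^(r-2) are 2 < 9/4 and 4 < 9/2, so the linear and cubic
  bounds give degree 4 in r on the left. The right side has degree 5.\<close>

lemma tuple_count_two_power_ineq:
  assumes "r \<ge> 400000"
  defines "n \<equiv> 2 ^ r"
  shows "(tuple_count (r - 1) n + tuple_count r n) *
      (tuple_count (r - 2) n + tuple_count (r - 1) n + tuple_count r n) < tuple_count r n * tuple_count (r - 3) n"
proof -
  have pow: "(2::nat) ^ r = 2 ^ i * 2 ^ (r - i)" if "i \<le> r" for i
    using that by (simp flip: power_add)
  have d0: "tuple_count r n = 1"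
    using tuple_count_le_1[of n r] binomial_le_tuple_count[of 0 r n] by (simp add: n_def)
  have d1: "tuple_count (r - 1) n \<le> 2 * (r - 1) + 1"
    by (rule tuple_count_le_linear) (use assms pow[of 1] in simp)
  have d2: "tuple_count (r - 2) n \<le> (2 * (r - 2) + 1) ^ 3"
    by (rule tuple_count_le_cubic) (use assms pow[of 2] in simp)
  have d3: "(r - 3) choose 5 \<le> tuple_count (r - 3) n"
  \<comment> \<open>Five entries 3 fit because 3^5 = 243 \<le> 256 = 2^8.\<close>
  proof (rule binomial_le_tuple_count)
    have "2 ^ (r - 3 - 5) * 3 ^ 5 \<le> (2 :: nat) ^ (r - 8) * 2 ^ 8" by simp
    also have "\<dots> = n" using pow[of 8] assms by (simp add: mult.commute)
    finally show "2 ^ (r - 3 - 5) * 3 ^ 5 \<le> n" .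
  qed (use assms in auto)
  define x where "x = real (r - 3)"
  have x: "x \<ge> 399997" using assms(1) by (simp add: x_def)
  have "real ((tuple_count (r - 1) n + tuple_count r n) *
      (tuple_count (r - 2) n + tuple_count (r - 1) n + tuple_count r n))
      \<le> real ((2 * (r - 1) + 1 + 1) * ((2 * (r - 2) + 1) ^ 3 + (2 * (r - 1) + 1) + 1))"
    unfolding d0 of_nat_le_iff using d1 d2 by (intro mult_mono add_mono) auto
  also have "\<dots> = (2 * x + 6) * ((2 * x + 3) ^ 3 + (2 * x + 6))"
  proof -
    have "2 * (r - 1) + 1 + 1 = 2 * (r - 3) + 6" "2 * (r - 2) + 1 = 2 * (r - 3) + 3"
      "a + (2 * (r - 1) + 1) + 1 = a + (2 * (r - 3) + 6)" for a
      using assms(1) by auto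
    then show ?thesis by (simp only: x_def of_nat_mult of_nat_add of_nat_power of_nat_numeral)
  qed
  also have "\<dots> \<le> (3 * x) * ((3 * x) ^ 3 + 3 * x ^ 3)"
  proof (intro mult_mono add_mono power_mono)
    have "x ^ 1 \<le> x ^ 3" by (rule power_increasing) (use x in auto)
    then show "2 * x + 6 \<le> 3 * x ^ 3" using x by simp
  qed (use x in auto)
  also have "\<dots> = 90 * x ^ 4" by (simp add: power_def algebra_simps)
  \<comment> \<open>Here 3125 = 5^5 comes from the lower bound (x/5)^5 for the binomial coefficient;
    x > 90 * 3125 = 281250 explains the size of r.\<close>
  also have "\<dots> < x ^ 5 / 3125"
  proof -
    have "x ^ 4 * (90 * 3125) < x ^ 4 * x" using x by (intro mult_strict_left_mono) auto
    then show ?thesis by (simp add: eval_nat_numeral mult_ac)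
  qed
  also have "\<dots> = (real (r - 3) / real 5) ^ 5" by (simp add: x_def power_divide)
  also have "\<dots> \<le> real ((r - 3) choose 5)"
    by (rule binomial_ge_n_over_k_pow_k) (use assms(1) in auto)
  also have "\<dots> \<le> real (tuple_count r n * tuple_count (r - 3) n)"
    using d0 d3 by simp
  finally show ?thesis unfolding of_nat_less_iff .
qed

text \<open>With r = 2 s and R = 2^s / 2 this is exactly 4 r^3 < R.\<close>

lemma cube_less_two_power: "s \<ge> 20 \<Longrightarrow> 64 * s ^ 3 < (2::nat) ^ s"
proof (induction s rule: nat_induct_at_least)
  case (Suc s)
  have "20 * s \<le> s * s" "20 * (s * s) \<le> s * (s * s)"
    using Suc.hyps by (rule mult_le_mono1)+
  moreover have "Suc s ^ 3 = s * (s * s) + 3 * (s * s) + 3 * s + 1" "s ^ 3 = s * (s * s)"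
    by (simp_all add: power3_eq_cube algebra_simps)
  ultimately have "64 * Suc s ^ 3 \<le> 2 * (64 * s ^ 3)"
    using Suc.hyps by linarith
  then show ?case using Suc.IH by simp
qed simp

theorem theorem5p3:
  shows "(\<exists>n\<ge>2. \<exists>\<mu>. small_nontrivial_eigenvalue n \<mu> \<and> cmod \<mu> > 1 \<and> Re \<mu> > 1) \<and>
    \<not> (\<forall>n\<ge>2. \<forall>\<mu>. small_nontrivial_eigenvalue n \<mu> \<longrightarrow> cmod \<mu> < 1) \<and>
    \<not> (\<forall>n\<ge>2. \<forall>\<mu>. small_nontrivial_eigenvalue n \<mu> \<longrightarrow> Re \<mu> < 1)"
proof -
  \<comment> \<open>An even exponent r = 2 s makes n a perfect square, with R half its root; the
    bound on s gives r \<ge> 400000.\<close>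
  obtain s :: nat where s: "s \<ge> 200000" by blast
  define r n where "r = 2 * s" and "n = (2::nat) ^ r"
  define R :: real where "R = 2 ^ s / 2"
  have r: "r \<ge> 400000" "r > 0" "r > 3" using s by (auto simp: r_def)
  have "real (64 * s ^ 3) < real (2 ^ s)"
    unfolding of_nat_less_iff by (rule cube_less_two_power) (use s in simp)
  then have "4 * real r ^ 3 < R" by (simp add: r_def R_def power_mult_distrib)
  moreover have "real n = 4 * R\<^sup>2"
    by (simp add: n_def r_def R_def power_divide power_mult mult.commute power_even_eq)
  ultimately obtain u v :: real where u: "u > 1" "v < 0" "poly (redheffer_poly r n) u = 0"
      "poly (pderiv (redheffer_poly r n)) (complex_of_real u) \<noteq> 0"
    and pair: "large_eigenvalue_pair n (1 + of_real u) (1 + of_real v)"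
    and small: "\<And>z. poly (redheffer_poly r n) z = 0 \<Longrightarrow> z \<noteq> of_real u \<Longrightarrow> z \<noteq> of_real v \<Longrightarrow>
      1 + z \<in># nontrivial_eigenvalues n - {#1 + of_real u, 1 + of_real v#}"
    using large_pair_two_power[OF n_def _ _ r(2)] by blast
  have "\<exists>z. poly (redheffer_poly r n) z = 0 \<and> z \<noteq> complex_of_real u \<and> Re z > 0"
    by (rule redheffer_poly_unstable) (use u r tuple_count_two_power_ineq[of r] in \<open>auto simp: n_def\<close>)
  then obtain z where z: "poly (redheffer_poly r n) z = 0" "z \<noteq> of_real u" "Re z > 0" by blast
  \<comment> \<open>As v is negative, a root with positive real part other than u lies outside the
    large pair.\<close>
  then have "z \<noteq> of_real v" using u by auto
  then have small: "small_nontrivial_eigenvalue n (1 + z)"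
    unfolding small_nontrivial_eigenvalue_def using pair small z by blast
  have Re: "Re (1 + z) > 1" using z by simp
  then have norm: "cmod (1 + z) > 1" using complex_Re_le_cmod[of "1 + z"] by linarith
  have n: "n \<ge> 2" using r self_le_power[of 2 r] by (simp add: n_def)
  from n small Re norm show ?thesis by (meson less_asym)
qed

end
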